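(* Let $P$ be a polytope of type $\mathbf A$. Then the lattice dicing subdivision of $P$ obtained by slicing $P$ by all lattice hyperplanes with normal in the root system $\mathbf A_{n-1}$ is a quadratic triangulation of $P$.
   Context: Let $\mathbf A_{n-1}=\{e_i-e_j: i\ne j,\ 1\le i,j\le n\}\subset\mathbb{R}^n$, $V=\{x\in\mathbb{R}^n:\sum_i x_i=0\}$, and $\Lambda^*=\{x\in V:\langle v,x\rangle\in\mathbb{Z}\ \forall v\in\mathbf A_{n-1}\}$. A polytope of type $\mathbf A$ is a lattice polytope with respect to $\Lambda^*$ (vertices in $\Lambda^*$), full-dimensional in $V$, each of whose facet-defining hyperplanes has the form $\{x\in V:\langle v,x\rangle=w\}$ with $v\in\mathbf A_{n-1}$, $w\in\mathbb{Z}$. The lattice hyperplanes with normal in $\mathbf A_{n-1}$ are $\{x\in V:\langle e_i-e_j,x\rangle=k\}$, $k\in\mathbb{Z}$. A quadratic triangulation is a triangulation that is regular (induced by a weight vector on the lattice points), unimodular with respect to $\Lambda^*$, and flag (every minimal non-face has two elements). *)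

theory Defs
  imports "HOL-Analysis.Analysis"
begin

section \<open>Lattice triangulations\<close>

definition vertices :: "'a::real_vector set \<Rightarrow> 'a set" where
  "vertices S = {x. x extreme_point_of S}"

definition lattice_basis :: "'a::euclidean_space set \<Rightarrow> 'a set \<Rightarrow> bool" where
  "lattice_basis L B \<longleftrightarrow>
     independent B \<and> L = {\<Sum>b\<in>B. real_of_int (c b) *\<^sub>R b | c :: 'a \<Rightarrow> int. True}"

definition lattice_polytope :: "'a::euclidean_space set \<Rightarrow> 'a set \<Rightarrow> bool" where
  "lattice_polytope L P \<longleftrightarrow> polytope P \<and> vertices P \<subseteq> L"

text \<open>
  Simplicial complexes of the library are closed under taking faces, so they contain the
  empty simplex and simplices of every dimension.
\<close>

definition lattice_triangulation ::
    "'a::euclidean_space set \<Rightarrow> 'a set \<Rightarrow> 'a set set \<Rightarrow> bool" where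
  "lattice_triangulation L P \<T> \<longleftrightarrow>
     simplicial_complex \<T> \<and> \<Union>\<T> = P \<and> (\<forall>S\<in>\<T>. lattice_polytope L S)"

text \<open>
  The edge vectors at every vertex form a basis of the lattice induced on their linear span.
  This makes sense for simplices of any dimension; for full-dimensional ones
  the induced lattice is the whole of \<open>L\<close>.
\<close>

definition unimodular_simplex :: "'a::euclidean_space set \<Rightarrow> 'a set \<Rightarrow> bool" where
  "unimodular_simplex L S \<longleftrightarrow>
     lattice_polytope L S \<and>
     (\<forall>v\<in>vertices S.
        let E = {u - v | u. u \<in> vertices S - {v}} in lattice_basis (L \<inter> span E) E)"

definition unimodular :: "'a::euclidean_space set \<Rightarrow> 'a set set \<Rightarrow> bool" where
  "unimodular L \<T> \<longleftrightarrow> (\<forall>S\<in>\<T>. unimodular_simplex L S)"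

text \<open>
  The regular subdivision of \<open>P\<close> induced by the weights \<open>\<omega>\<close>: lift every lattice point \<open>a\<close> of \<open>P\<close>
  to height \<open>\<omega> a\<close> and project the lower faces of the convex hull, that is, the faces
  minimizing a functional whose last coordinate is \<open>1\<close>.  Non-tight lower bounds give
  the empty face.
\<close>

definition lifted_polytope ::
    "'a::euclidean_space set \<Rightarrow> 'a set \<Rightarrow> ('a \<Rightarrow> real) \<Rightarrow> ('a \<times> real) set" where
  "lifted_polytope L P \<omega> = convex hull {(a, \<omega> a) | a. a \<in> P \<inter> L}"

definition lower_face :: "('a::euclidean_space \<times> real) set \<Rightarrow> ('a \<times> real) set \<Rightarrow> bool" where
  "lower_face F Q \<longleftrightarrow>
     (\<exists>u b. Q \<subseteq> {z. b \<le> (u, 1) \<bullet> z} \<and> F = Q \<inter> {z. (u, 1) \<bullet> z = b})"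

definition regular_subdivision ::
    "'a::euclidean_space set \<Rightarrow> 'a set \<Rightarrow> ('a \<Rightarrow> real) \<Rightarrow> 'a set set" where
  "regular_subdivision L P \<omega> = {fst ` F | F. lower_face F (lifted_polytope L P \<omega>)}"

definition regular :: "'a::euclidean_space set \<Rightarrow> 'a set \<Rightarrow> 'a set set \<Rightarrow> bool" where
  "regular L P \<T> \<longleftrightarrow> (\<exists>\<omega>. \<T> = regular_subdivision L P \<omega>)"

text \<open>Faces and non-faces are those of the abstract complex on the vertices of the simplices.\<close>

definition complex_vertices :: "'a::euclidean_space set set \<Rightarrow> 'a set" where
  "complex_vertices \<T> = \<Union> (vertices ` \<T>)"

definition minimal_nonface :: "'a::euclidean_space set set \<Rightarrow> 'a set \<Rightarrow> bool" where
  "minimal_nonface \<T> W \<longleftrightarrow>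
     W \<subseteq> complex_vertices \<T> \<and> W \<notin> vertices ` \<T> \<and> (\<forall>U. U \<subset> W \<longrightarrow> U \<in> vertices ` \<T>)"

definition flag :: "'a::euclidean_space set set \<Rightarrow> bool" where
  "flag \<T> \<longleftrightarrow> (\<forall>W. minimal_nonface \<T> W \<longrightarrow> card W = 2)"

definition quadratic_triangulation ::
    "'a::euclidean_space set \<Rightarrow> 'a set \<Rightarrow> 'a set set \<Rightarrow> bool" where
  "quadratic_triangulation L P \<T> \<longleftrightarrow>
     lattice_triangulation L P \<T> \<and> regular L P \<T> \<and> unimodular L \<T> \<and> flag \<T>"


section \<open>Polytopes of type A\<close>

text \<open>The index type \<open>'n\<close> plays the role of \<open>{1, \<dots>, n}\<close>.\<close>

definition root_system_A :: "(real ^ 'n) set" where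
  "root_system_A = {axis i 1 - axis j 1 | i j. i \<noteq> j}"

definition V_A :: "(real ^ 'n) set" where
  "V_A = {x. (\<Sum>i\<in>UNIV. x $ i) = 0}"

definition lattice_A :: "(real ^ 'n) set" where
  "lattice_A = {x \<in> V_A. \<forall>v\<in>root_system_A. v \<bullet> x \<in> \<int>}"

definition polytope_type_A :: "(real ^ 'n) set \<Rightarrow> bool" where
  "polytope_type_A P \<longleftrightarrow>
     lattice_polytope lattice_A P \<and>
     P \<subseteq> V_A \<and> aff_dim P = aff_dim (V_A :: (real ^ 'n) set) \<and>
     (\<forall>F. F facet_of P \<longrightarrow>
        (\<exists>v\<in>root_system_A. \<exists>w::int. affine hull F = {x \<in> V_A. v \<bullet> x = real_of_int w}))"

definition lattice_hyperplanes_A :: "(real ^ 'n) set set" where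
  "lattice_hyperplanes_A =
     {{x \<in> V_A. v \<bullet> x = real_of_int k} | v k. v \<in> root_system_A}"

text \<open>
  The maximal cells obtained by slicing \<open>P\<close> are the closures of the connected components
  of \<open>P\<close> minus all the hyperplanes; the subdivision consists of these cells and their faces.
\<close>

definition slicing :: "'a::euclidean_space set \<Rightarrow> 'a set set \<Rightarrow> 'a set set" where
  "slicing P \<H> = {F. \<exists>C\<in>components (P - \<Union>\<H>). F face_of closure C}"

definition lattice_dicing_A :: "(real ^ 'n) set \<Rightarrow> (real ^ 'n) set set" where
  "lattice_dicing_A P = slicing P lattice_hyperplanes_A"

end

theory Submission
  imports Defs
begin

text \<open>
  Call two lattice points adjacent if all roots take values in \<open>{-1, 0, 1}\<close> on their
  difference.  The dicing of \<open>P\<close> is the clique complex of this graph on \<open>P \<inter> \<Lambda>\<^sup>*\<close>, which makes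
  it flag.  The key is that in a clique \<open>W\<close> every \<open>a \<in> W\<close> admits a root \<open>e\<^sub>i - e\<^sub>j\<close> which takes
  one value at \<open>a\<close> and that value plus \<open>1\<close> on the rest of \<open>W\<close>; such roots read off the
  coefficients of linear combinations, so cliques span unimodular simplices.  If \<open>x\<close> is a convex
  combination of a clique, the points with positive weight are exactly the lattice points \<open>a\<close>
  for which all roots are less than \<open>1\<close> on \<open>x - a\<close>.  This set, the carrier of \<open>x\<close>, does not
  depend on the clique, so simplices meet in common faces, and it is constant on the
  components of the complement of the hyperplanes.  Finally the dicing is regular for the
  weights \<open>\<Sum> (a\<^sub>i - a\<^sub>j)\<^sup>2\<close>, because \<open>(t - k) (t - k - 1) \<ge> 0\<close> for integers \<open>t\<close> and \<open>k\<close>,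
  with equality only at the two ends of the unit interval from \<open>k\<close>.
\<close>

section \<open>Cliques of lattice points\<close>

text \<open>The value of the root \<open>e_i - e_j\<close> at \<open>x\<close>. Allowing
  \<open>i = j\<close>, where it is 0, lets bounds range over all pairs of indices.\<close>

definition gap :: "'n \<Rightarrow> 'n \<Rightarrow> real ^ 'n \<Rightarrow> real" where
  "gap i j x = x $ i - x $ j"

lemma gap_add: "gap i j (x + y) = gap i j x + gap i j y"
  and gap_diff: "gap i j (x - y) = gap i j x - gap i j y"
  and gap_scaleR: "gap i j (c *\<^sub>R x) = c * gap i j x"
  and gap_minus: "gap i j (- x) = - gap i j x"
  and gap_self: "gap i i x = 0"
  by (simp_all add: gap_def algebra_simps)

lemma gap_sum: "gap i j (\<Sum>b\<in>B. f b) = (\<Sum>b\<in>B. gap i j (f b))"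
  by (simp add: gap_def sum_subtractf)

lemma gap_swap: "gap i j x = - gap j i x"
  by (simp add: gap_def)

lemma gap_trans: "gap i k x = gap i j x + gap j k x"
  by (simp add: gap_def)

lemma inner_root: "(axis i 1 - axis j 1) \<bullet> (x :: real ^ 'n) = gap i j x"
  by (simp add: gap_def inner_diff_left inner_axis_axis inner_axis')

lemma continuous_on_gap [continuous_intros]:
  "continuous_on S f \<Longrightarrow> continuous_on S (\<lambda>x. gap i j (f x))"
  unfolding gap_def by (intro continuous_intros)

lemma subspace_V_A: "subspace (V_A :: (real ^ 'n) set)"
  by (auto simp: subspace_def V_A_def sum.distrib simp flip: sum_distrib_left)

text \<open>Equal gaps leave only a common shift of all coordinates, and the zero coordinate sum in
  \<open>V_A\<close> makes that shift vanish.\<close>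

lemma gap_zero_imp_eq:
  fixes x y :: "real ^ 'n"
  assumes "x \<in> V_A" "y \<in> V_A" "\<And>i j. gap i j x = gap i j y"
  shows "x = y"
proof -
  have "x $ i - y $ i = x $ j - y $ j" for i j
    using assms(3)[of i j] by (simp add: gap_def)
  then have "(\<Sum>j\<in>(UNIV :: 'n set). x $ i - y $ i) = (\<Sum>j\<in>UNIV. x $ j - y $ j)" for i
    by (intro sum.cong) auto
  also have "\<dots> = 0"
    using assms(1,2) by (simp add: V_A_def sum_subtractf)
  finally show ?thesis
    by (simp add: vec_eq_iff)
qed

lemma lattice_A_iff: "a \<in> lattice_A \<longleftrightarrow> a \<in> V_A \<and> (\<forall>i j. gap i j a \<in> \<int>)"
  unfolding lattice_A_def root_system_A_def
  by (auto simp: inner_root) (metis gap_self Ints_0 inner_root)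

lemma lattice_A_subset: "lattice_A \<subseteq> V_A"
  by (auto simp: lattice_A_def)

lemma Ints_abs_less_one: "x \<in> \<int> \<Longrightarrow> \<bar>x\<bar> < 1 \<Longrightarrow> x = (0::real)"
  by (auto elim!: Ints_cases)

lemma Ints_less_two: "x \<in> \<int> \<Longrightarrow> x < 2 \<Longrightarrow> x \<le> (1::real)"
  by (auto elim!: Ints_cases)

section \<open>Cliques and the roots that isolate one vertex\<close>

text \<open>Exchanging \<open>i\<close> and \<open>j\<close> changes the sign, so the bound is
  two-sided; by integrality the differences are -1, 0 or 1. The empty set is a clique and stands for
  the empty face.\<close>

definition root_clique :: "(real ^ 'n) set \<Rightarrow> bool" where
  "root_clique W \<longleftrightarrow> W \<subseteq> lattice_A \<and> (\<forall>a\<in>W. \<forall>b\<in>W. \<forall>i j. gap i j a - gap i j b \<le> 1)"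

lemma root_clique_subset: "root_clique W \<Longrightarrow> U \<subseteq> W \<Longrightarrow> root_clique U"
  unfolding root_clique_def by blast

lemma root_clique_insert:
  "root_clique (insert a W) \<longleftrightarrow> root_clique W \<and> a \<in> lattice_A \<and>
     (\<forall>b\<in>W. \<forall>i j. gap i j a - gap i j b \<le> 1)"
proof -
  have "gap i j b - gap i j a \<le> 1" if "\<forall>i j. gap i j a - gap i j b \<le> 1" for i j b
    using that[rule_format, of j i] gap_swap[of i j] by (smt (verit))
  then show ?thesis
    unfolding root_clique_def by auto
qed

lemma root_clique_uminus: "root_clique W \<Longrightarrow> root_clique (uminus ` W)"
proof -
  assume W: "root_clique W"
  have "- a \<in> lattice_A" if "a \<in> lattice_A" for a
    using that subspace_V_A subspace_neg by (auto simp: lattice_A_iff gap_minus)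
  with W show ?thesis
    by (auto simp: root_clique_def gap_minus)
qed

text \<open>If the difference 1 never occurs, neither does -1, by exchanging indices; then all gaps
  agree and the points coincide.\<close>

lemma root_clique_exists_gap:
  assumes W: "root_clique W" and "a \<in> W" "b \<in> W" "b \<noteq> a"
  shows "\<exists>i j. gap i j b - gap i j a = 1"
proof (rule ccontr)
  assume *: "\<not> ?thesis"
  have "gap i j b = gap i j a" for i j
  proof -
    have int: "gap i j b - gap i j a \<in> \<int>"
      using assms by (auto simp: root_clique_def lattice_A_iff subset_iff)
    have "gap i j b - gap i j a \<le> 1" "gap i j b - gap i j a \<ge> -1"
      using assms by (auto simp: root_clique_def) (smt (verit))
    moreover have "gap i j b - gap i j a \<noteq> 1" using * by blast
    moreover have "gap i j b - gap i j a \<noteq> -1"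
    proof
      assume "gap i j b - gap i j a = -1"
      then have "gap j i b - gap j i a = 1" by (simp add: gap_def)
      with * show False by blast
    qed
    ultimately have "gap i j b - gap i j a = 0"
      by (intro Ints_abs_less_one[OF int]) auto
    then show ?thesis by simp
  qed
  then show False
    using gap_zero_imp_eq[of b a] assms lattice_A_subset by (auto simp: root_clique_def)
qed

text \<open>
  Up to a constant vector, every \<open>b - a\<close> is the indicator of the set \<open>S b\<close> below;
  the clique condition says that these sets form a chain, so a smallest one is
  contained in all others.
\<close>

lemma root_clique_common_top:
  assumes W: "root_clique W" and a: "a \<in> W"
  shows "\<exists>i. \<forall>b\<in>W - {a}. \<exists>k. gap i k b - gap i k a = 1"
proof (cases "W - {a} = {}")
  case False
  define S where "S b = {i. \<exists>k. gap i k b - gap i k a = 1}" for b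
  have fin: "finite (S b)" for b by simp
  have le: "gap i j x - gap i j y \<le> 1" if "x \<in> W" "y \<in> W" for i j x y
    using W that by (auto simp: root_clique_def)
  have chain: "S b \<subseteq> S c \<or> S c \<subseteq> S b" if "b \<in> W" "c \<in> W" for b c
  proof (rule ccontr)
    assume "\<not> ?thesis"
    then obtain i k where ik: "i \<in> S b" "i \<notin> S c" "k \<in> S c" "k \<notin> S b" by blast
    \<comment> \<open>With \<open>l\<close> a witness for \<open>x\<close>, the increment of
      \<open>gap y l\<close> from \<open>a\<close> to \<open>d\<close> is an integer at most 1 but
      not 1, hence at most 0; additivity of gaps gives the bound.\<close>
    have ge_1: "gap x y d - gap x y a \<ge> 1" if "d \<in> W" "x \<in> S d" "y \<notin> S d" for x y d
    proof -
      obtain l where l: "gap x l d - gap x l a = 1" using \<open>x \<in> S d\<close> by (auto simp: S_def)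
      have "gap y l d - gap y l a \<noteq> 1" using \<open>y \<notin> S d\<close> by (auto simp: S_def)
      moreover have "gap y l d - gap y l a \<le> 1" using le that(1) a by blast
      moreover have "gap y l d - gap y l a \<in> \<int>"
        using W that(1) a by (auto simp: root_clique_def lattice_A_iff subset_iff)
      ultimately have "gap y l d - gap y l a \<le> 0"
        by (auto elim!: Ints_cases)
      then show ?thesis
        using l gap_trans[of x l d y] gap_trans[of x l a y] by simp
    qed
    \<comment> \<open>Incomparable sets would push \<open>b\<close> and \<open>c\<close> apart by 2,
      against the clique bound.\<close>
    have "gap i k b - gap i k a \<ge> 1" "gap k i c - gap k i a \<ge> 1"
      using ge_1 ik that by auto
    then have "gap i k b - gap i k c \<ge> 2"
      using gap_swap[of i k] by (smt (verit))
    then show False using le[OF that, of i k] by simp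
  qed
  obtain b0 where b0: "b0 \<in> W - {a}" "\<And>b. b \<in> W - {a} \<Longrightarrow> card (S b0) \<le> card (S b)"
    using ex_has_least_nat[of "\<lambda>b. b \<in> W - {a}" _ "\<lambda>b. card (S b)"] False by blast
  obtain i where i: "i \<in> S b0"
    using root_clique_exists_gap[OF W a, of b0] b0(1) by (auto simp: S_def)
  have "S b0 \<subseteq> S b" if "b \<in> W - {a}" for b
    using chain[of b0 b] b0 that card_seteq[OF fin, of "S b" b0] by auto
  with i have "\<forall>b\<in>W - {a}. i \<in> S b" by blast
  then show ?thesis by (auto simp: S_def)
qed auto

text \<open>A common top index \<open>i\<close> of the clique and a common bottom index
  \<open>j\<close>, found by negating the clique, work together for every \<open>b\<close>. On the
  hull of \<open>W\<close> this root is the barycentric coordinate of \<open>a\<close> up to sign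
  and a constant.\<close>

lemma root_clique_coordinate:
  assumes W: "root_clique W" and a: "a \<in> W"
  obtains i j where "\<And>b. b \<in> W \<Longrightarrow> b \<noteq> a \<Longrightarrow> gap i j b = gap i j a + 1"
proof -
  obtain i where i: "\<forall>b\<in>W - {a}. \<exists>k. gap i k b - gap i k a = 1"
    using root_clique_common_top[OF W a] by blast
  obtain j where j0: "\<forall>b\<in>uminus ` W - {- a}. \<exists>k. gap j k b - gap j k (- a) = 1"
    using root_clique_common_top[OF root_clique_uminus[OF W], of "- a"] a by blast
  then have j: "\<exists>k. gap k j b - gap k j a = 1" if "b \<in> W" "b \<noteq> a" for b
  proof -
    have "- b \<in> uminus ` W - {- a}" using that by auto
    then obtain k where "gap j k (- b) - gap j k (- a) = 1"
      using j0 by blast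
    then have "gap k j b - gap k j a = 1"
      by (simp add: gap_def)
    then show ?thesis ..
  qed
  have "gap i j b = gap i j a + 1" if b: "b \<in> W" "b \<noteq> a" for b
  proof -
    obtain k where k: "gap i k b - gap i k a = 1" using i b by blast
    obtain l where l: "gap l j b - gap l j a = 1" using j b by blast
    have "gap l k b - gap l k a \<le> 1" "gap i j b - gap i j a \<le> 1"
      using W a b by (auto simp: root_clique_def)
    \<comment> \<open>Exchanging second indices keeps the sum of two gaps. From \<open>a\<close> to
      \<open>b\<close> the right sides grow by 2 and each gap on the left by at most 1, so each
      grows by exactly 1.\<close>
    moreover have "gap i j b + gap l k b = gap i k b + gap l j b"
      "gap i j a + gap l k a = gap i k a + gap l j a"
      by (simp_all add: gap_def)
    ultimately show ?thesis using k l by simp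
  qed
  then show thesis using that by blast
qed

text \<open>The root isolating \<open>a\<close> is constant on the affine hull of the other points
  and has another value at \<open>a\<close>.\<close>

lemma root_clique_affine_independent:
  assumes W: "root_clique W"
  shows "\<not> affine_dependent W"
proof
  assume "affine_dependent W"
  then obtain a where a: "a \<in> W" "a \<in> affine hull (W - {a})"
    by (auto simp: affine_dependent_def)
  obtain i j where ij: "\<And>b. b \<in> W \<Longrightarrow> b \<noteq> a \<Longrightarrow> gap i j b = gap i j a + 1"
    using root_clique_coordinate[OF W a(1)] by blast
  have "affine {x. gap i j x = gap i j a + 1}"
    by (simp add: affine_def gap_add gap_scaleR flip: distrib_right)
  then have "affine hull (W - {a}) \<subseteq> {x. gap i j x = gap i j a + 1}"
    using ij by (intro hull_minimal) auto
  with a show False by auto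
qed

lemma root_clique_finite: "root_clique W \<Longrightarrow> finite W"
  using aff_independent_finite root_clique_affine_independent by blast

section \<open>Carriers\<close>

text \<open>Only the lattice enters here, not a polytope; that the carrier of a point of
  \<open>P\<close> stays in \<open>P\<close> is where the facet normals being roots is used.\<close>

definition carrier :: "real ^ 'n \<Rightarrow> (real ^ 'n) set" where
  "carrier x = {a \<in> lattice_A. \<forall>i j. gap i j x - gap i j a < 1}"

text \<open>Strict bounds by 1 on both sides of \<open>x\<close> give differences below 2, hence at
  most 1 by integrality.\<close>

lemma root_clique_carrier: "root_clique (carrier x)"
  unfolding root_clique_def
proof (intro conjI ballI allI)
  fix a b i j assume a: "a \<in> carrier x" and b: "b \<in> carrier x"
  have "gap i j x - gap i j b < 1" "gap j i x - gap j i a < 1"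
    using a b by (auto simp: carrier_def)
  then have "gap i j a - gap i j b < 2"
    using gap_swap[of i j] by (smt (verit))
  moreover have "gap i j a - gap i j b \<in> \<int>"
    using a b by (auto simp: carrier_def lattice_A_iff)
  ultimately show "gap i j a - gap i j b \<le> 1" by (rule Ints_less_two[rotated])
qed (auto simp: carrier_def)

text \<open>A point of positive weight contributes nothing to its own difference from
  \<open>?x\<close>, and the remaining terms add up to less than 1. Conversely, a carrier point
  outside the support could be joined to it as a clique, and the root isolating this point would be
  larger by exactly 1 at \<open>?x\<close>.\<close>

lemma carrier_convex_combination:
  assumes W: "root_clique W" and nonneg: "\<And>b. b \<in> W \<Longrightarrow> 0 \<le> c b" and one: "sum c W = 1"
  shows "carrier (\<Sum>b\<in>W. c b *\<^sub>R b) = {b \<in> W. 0 < c b}" (is "carrier ?x = ?W'")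
proof -
  have fin: "finite W" using W by (rule root_clique_finite)
  have gx: "gap i j ?x = (\<Sum>b\<in>W. c b * gap i j b)" for i j
    by (simp add: gap_sum gap_scaleR)
  have gxa: "gap i j ?x - gap i j a = (\<Sum>b\<in>W. c b * (gap i j b - gap i j a))" for i j a
    using one by (simp add: gx right_diff_distrib sum_subtractf flip: sum_distrib_right)
  have sub: "?W' \<subseteq> carrier ?x"
  proof
    fix a assume a: "a \<in> ?W'"
    have "gap i j ?x - gap i j a < 1" for i j
    proof -
      have "gap i j ?x - gap i j a = (\<Sum>b\<in>W - {a}. c b * (gap i j b - gap i j a))"
        unfolding gxa using a fin by (simp add: sum.remove[of W a])
      also have "\<dots> \<le> (\<Sum>b\<in>W - {a}. c b * 1)"
        using W a nonneg by (intro sum_mono mult_left_mono) (auto simp: root_clique_def)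
      also have "\<dots> < 1"
        using a fin one by (simp add: sum_diff1)
      finally show ?thesis .
    qed
    then show "a \<in> carrier ?x"
      using a W by (auto simp: carrier_def root_clique_def)
  qed
  moreover have "carrier ?x \<subseteq> ?W'"
  proof
    fix a assume a: "a \<in> carrier ?x"
    show "a \<in> ?W'"
    proof (rule ccontr)
      assume na: "a \<notin> ?W'"
      have "root_clique (insert a ?W')"
        using root_clique_subset[OF root_clique_carrier] a sub by blast
      then obtain i j where ij: "\<And>b. b \<in> insert a ?W' \<Longrightarrow> b \<noteq> a \<Longrightarrow> gap i j b = gap i j a + 1"
        using root_clique_coordinate by blast
      have "gap i j ?x - gap i j a = (\<Sum>b\<in>W. c b)"
        unfolding gxa
      proof (rule sum.cong)
        fix b assume "b \<in> W"
        show "c b * (gap i j b - gap i j a) = c b"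
        proof (cases "c b = 0")
          case False
          then have "b \<in> ?W'" using \<open>b \<in> W\<close> nonneg[of b] by auto
          with ij[of b] na show ?thesis by fastforce
        qed simp
      qed simp
      with one a show False by (auto simp: carrier_def) (metis less_irrefl)
    qed
  qed
  ultimately show ?thesis by blast
qed

lemma carrier_subset_if_in_hull:
  assumes W: "root_clique W" and x: "x \<in> convex hull W"
  shows "carrier x \<subseteq> W" and "x \<in> convex hull (carrier x)"
proof -
  have fin: "finite W" using W by (rule root_clique_finite)
  obtain c where c: "\<And>b. b \<in> W \<Longrightarrow> 0 \<le> c b" "sum c W = 1" "x = (\<Sum>b\<in>W. c b *\<^sub>R b)"
    using x fin by (auto simp: convex_hull_finite)
  have eq: "carrier x = {b \<in> W. 0 < c b}"
    using carrier_convex_combination[OF W c(1,2)] c(3) by simp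
  then show "carrier x \<subseteq> W" by auto
  have "sum c (carrier x) = sum c W" "(\<Sum>b\<in>carrier x. c b *\<^sub>R b) = (\<Sum>b\<in>W. c b *\<^sub>R b)"
    using eq c(1) fin by (auto intro!: sum.mono_neutral_left simp: less_le)
  then show "x \<in> convex hull (carrier x)"
    using c eq fin by (auto simp: convex_hull_finite intro!: exI[of _ c])
qed

text \<open>Subtracting the mean of the coordinates moves a vector into \<open>V_A\<close> and keeps
  its gaps.\<close>

lemma exists_with_gaps: "\<exists>x\<in>(V_A :: (real ^ 'n) set). \<forall>i j. gap i j x = f i - f j"
proof
  show "(\<chi> i. f i - (\<Sum>k\<in>UNIV. f k) / real CARD('n)) \<in> (V_A :: (real ^ 'n) set)"
    by (simp add: V_A_def sum_subtractf)
qed (simp add: gap_def)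

text \<open>Rounding every coordinate down and recentring works: each gap changes by a difference of
  two fractional parts.\<close>

lemma carrier_nonempty: "carrier x \<noteq> {}"
proof -
  obtain a where a: "a \<in> V_A" "\<And>i j. gap i j a = of_int \<lfloor>x $ i\<rfloor> - of_int \<lfloor>x $ j\<rfloor>"
    using exists_with_gaps[of "\<lambda>i. of_int \<lfloor>x $ i\<rfloor>"] by blast
  have "gap i j x - gap i j a < 1" for i j
    unfolding a(2) unfolding gap_def by linarith
  with a have "a \<in> carrier x"
    by (auto simp: carrier_def lattice_A_iff)
  then show ?thesis by blast
qed

text \<open>An integer of absolute value below 1 is 0. Thus a lattice hyperplane through
  \<open>x\<close> contains the whole carrier.\<close>

lemma gap_carrier_int:
  assumes "a \<in> carrier x" "gap i j x \<in> \<int>"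
  shows "gap i j a = gap i j x"
proof -
  have "gap i j x - gap i j a < 1" "gap j i x - gap j i a < 1"
    using assms by (auto simp: carrier_def)
  moreover have "gap i j x - gap i j a \<in> \<int>"
    using assms by (auto simp: carrier_def lattice_A_iff)
  ultimately have "gap i j x - gap i j a = 0"
    by (intro Ints_abs_less_one) (auto simp: gap_def)
  then show ?thesis by simp
qed

text \<open>
  A point of the carrier is used as the centre of a radial projection: pushing \<open>x\<close> away
  from it until some gap becomes integral reduces the number of non-integral gaps.
\<close>

lemma in_hull_carrier:
  fixes x :: "real ^ 'n"
  assumes "x \<in> V_A"
  shows "x \<in> convex hull (carrier x)"
proof -
  define N where "N x = {(i, j). gap i j (x :: real ^ 'n) \<notin> \<int>}" for x
  have fin: "finite (N x)" for x by simp
  \<comment> \<open>Any clique with \<open>x\<close> in its hull suffices, as it can then be cut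
    down to the carrier.\<close>
  have "\<exists>W. root_clique W \<and> x \<in> convex hull W"
    using assms
  proof (induction "card (N x)" arbitrary: x rule: less_induct)
    case less
    obtain a where a: "a \<in> carrier x" using carrier_nonempty by blast
    then have aL: "a \<in> lattice_A" and lt1: "\<And>i j. gap i j (x - a) < 1"
      by (auto simp: carrier_def gap_diff)
    show ?case
    proof (cases "x = a")
      case True
      then have "root_clique {a}" "x \<in> convex hull {a}"
        using aL by (auto simp: root_clique_def)
      then show ?thesis by blast
    next
      case False
      define G where "G = range (\<lambda>(i, j). gap i j (x - a))"
      have G: "finite G" "G \<noteq> {}" by (auto simp: G_def)
      define r where "r = Max G"
      have r_ge: "gap i j (x - a) \<le> r" for i j
        unfolding r_def using G by (intro Max_ge) (auto simp: G_def)
      have "r \<in> G" unfolding r_def using G by (rule Max_in)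
      then obtain i0 j0 where r: "gap i0 j0 (x - a) = r" by (auto simp: G_def)
      have "r < 1" using lt1[of i0 j0] r by simp
      have "r > 0"
      proof (rule ccontr)
        assume "\<not> r > 0"
        then have "gap i j (x - a) = 0" for i j
          using r_ge[of i j] r_ge[of j i] gap_swap[of i j "x - a"] by linarith
        then show False
          using gap_zero_imp_eq[of x a] less.prems aL False lattice_A_subset by (auto simp: gap_diff)
      qed
      \<comment> \<open>The point on the ray from \<open>a\<close> through \<open>x\<close> where
        the largest gap to \<open>a\<close> reaches 1.\<close>
      define y where "y = a + (1 / r) *\<^sub>R (x - a)"
      have gy: "gap i j y = gap i j a + gap i j (x - a) / r" for i j
        by (simp add: y_def gap_add gap_scaleR)
      have yV: "y \<in> V_A"
        unfolding y_def using subspace_V_A less.prems aL lattice_A_subset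
        by (intro subspace_add subspace_scale subspace_diff) auto
      have gap_ya: "gap i j y - gap i j a \<le> 1" for i j
        using r_ge[of i j] \<open>r > 0\<close> by (simp add: gy)
      \<comment> \<open>A gap that is integral at \<open>x\<close> has the same value at
        \<open>a\<close>, so it is constant along the ray and stays integral.\<close>
      have "N y \<subseteq> N x"
      proof
        fix p assume "p \<in> N y"
        then obtain i j where p: "p = (i, j)" "gap i j y \<notin> \<int>" by (auto simp: N_def)
        have "gap i j x \<notin> \<int>"
        proof
          assume "gap i j x \<in> \<int>"
          then have "gap i j a = gap i j x" by (rule gap_carrier_int[OF a])
          then have "gap i j y = gap i j a" by (simp add: gy gap_diff)
          with p aL show False by (simp add: lattice_A_iff)
        qed
        with p show "p \<in> N x" by (simp add: N_def)
      qed
      moreover have "(i0, j0) \<notin> N y"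
        using aL \<open>r > 0\<close> by (simp add: N_def gy r lattice_A_iff)
      moreover have "(i0, j0) \<in> N x"
        using gap_carrier_int[OF a, of i0 j0] r \<open>r > 0\<close> by (auto simp: N_def gap_diff)
      ultimately have "card (N y) < card (N x)"
        by (intro psubset_card_mono fin) blast
      then obtain W where W: "root_clique W" "y \<in> convex hull W"
        using less.hyps yV by blast
      \<comment> \<open>Gaps from \<open>a\<close> to \<open>y\<close> may equal 1, but those from
        \<open>y\<close> to its carrier are below 1; the sum is below 2, which integrality lowers to
        1.\<close>
      have clique: "root_clique (insert a (carrier y))"
        unfolding root_clique_insert
      proof (intro conjI root_clique_carrier aL ballI allI)
        fix b i j assume b: "b \<in> carrier y"
        have "gap i j y - gap i j b < 1" using b by (auto simp: carrier_def)
        moreover have "gap i j a - gap i j y \<le> 1"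
          using gap_ya[of j i] by (simp add: gap_def)
        ultimately have "gap i j a - gap i j b < 2" by linarith
        moreover have "gap i j a - gap i j b \<in> \<int>"
          using b aL by (auto simp: carrier_def lattice_A_iff)
        ultimately show "gap i j a - gap i j b \<le> 1" by (rule Ints_less_two[rotated])
      qed
      have "x = (1 - r) *\<^sub>R a + r *\<^sub>R y"
        using \<open>r > 0\<close> by (simp add: y_def algebra_simps)
      moreover have "y \<in> convex hull (insert a (carrier y))"
        using carrier_subset_if_in_hull(2)[OF W] hull_mono[of "carrier y" "insert a (carrier y)" convex]
        by blast
      moreover have "a \<in> convex hull (insert a (carrier y))"
        by (simp add: hull_inc)
      ultimately have "x \<in> convex hull (insert a (carrier y))"
        using convexD[OF convex_convex_hull, of a _ y "1 - r" r] \<open>r > 0\<close> \<open>r < 1\<close> by simp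
      with clique show ?thesis by blast
    qed
  qed
  then show ?thesis using carrier_subset_if_in_hull(2) by blast
qed

section \<open>Simplices spanned by cliques\<close>

lemma root_clique_hull_subset_V_A: "root_clique W \<Longrightarrow> convex hull W \<subseteq> V_A"
  using lattice_A_subset subspace_imp_convex[OF subspace_V_A]
  by (intro hull_minimal) (auto simp: root_clique_def)

lemma mem_hull_root_clique_iff:
  assumes "root_clique W"
  shows "x \<in> convex hull W \<longleftrightarrow> x \<in> V_A \<and> carrier x \<subseteq> W"
  using assms root_clique_hull_subset_V_A carrier_subset_if_in_hull(1) in_hull_carrier[of x]
    hull_mono[of "carrier x" W convex] by blast

lemma root_clique_is_carrier:
  assumes W: "root_clique W" and "W \<noteq> {}"
  obtains p where "p \<in> convex hull W" "carrier p = W"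
proof -
  have fin: "finite W" using W by (rule root_clique_finite)
  define c where "c b = 1 / real (card W)" for b :: "real ^ 'a"
  have c: "0 < c b" "sum c W = 1" for b
    using fin assms(2) by (auto simp: c_def card_gt_0_iff)
  then have "(\<Sum>b\<in>W. c b *\<^sub>R b) \<in> convex hull W"
    using fin less_imp_le by (auto simp: convex_hull_finite)
  moreover have "carrier (\<Sum>b\<in>W. c b *\<^sub>R b) = W"
    using carrier_convex_combination[OF W less_imp_le, OF c] c(1) by auto
  ultimately show thesis by (rule that)
qed

text \<open>All barycentric coordinates are positive exactly when the support is all of
  \<open>W\<close>. The open simplices are thus the fibres of \<open>carrier\<close> on
  \<open>V_A\<close>.\<close>

lemma rel_interior_hull_root_clique:
  assumes W: "root_clique W" and "W \<noteq> {}"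
  shows "rel_interior (convex hull W) = {x \<in> V_A. carrier x = W}"
proof -
  have fin: "finite W" using W by (rule root_clique_finite)
  have "x \<in> V_A \<and> carrier x = W \<longleftrightarrow>
      (\<exists>c. (\<forall>b\<in>W. 0 < c b) \<and> sum c W = 1 \<and> (\<Sum>b\<in>W. c b *\<^sub>R b) = x)" for x
  proof
    assume x: "x \<in> V_A \<and> carrier x = W"
    then have "x \<in> convex hull W" using in_hull_carrier by blast
    then obtain c where c: "\<forall>b\<in>W. 0 \<le> c b" "sum c W = 1" "(\<Sum>b\<in>W. c b *\<^sub>R b) = x"
      using fin by (auto simp: convex_hull_finite)
    moreover have "\<forall>b\<in>W. 0 < c b"
      using carrier_convex_combination[OF W _ c(2)] c x by auto
    ultimately show "\<exists>c. (\<forall>b\<in>W. 0 < c b) \<and> sum c W = 1 \<and> (\<Sum>b\<in>W. c b *\<^sub>R b) = x" by blast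
  next
    assume "\<exists>c. (\<forall>b\<in>W. 0 < c b) \<and> sum c W = 1 \<and> (\<Sum>b\<in>W. c b *\<^sub>R b) = x"
    then obtain c where c: "\<And>b. b \<in> W \<Longrightarrow> 0 < c b" "sum c W = 1" "(\<Sum>b\<in>W. c b *\<^sub>R b) = x"
      by blast
    then have eq: "carrier x = W"
      using carrier_convex_combination[OF W less_imp_le, OF c(1,2)] by auto
    have "x \<in> convex hull W"
      using fin c less_imp_le by (auto simp: convex_hull_finite)
    with eq show "x \<in> V_A \<and> carrier x = W"
      using root_clique_hull_subset_V_A[OF W] by blast
  qed
  then show ?thesis
    by (simp add: rel_interior_convex_hull_explicit root_clique_affine_independent[OF W])
qed

lemma face_of_hull_root_clique_iff:
  assumes "root_clique W"
  shows "F face_of convex hull W \<longleftrightarrow> (\<exists>U\<subseteq>W. F = convex hull U)"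
  using face_of_convex_hull_affine_independent[OF root_clique_affine_independent[OF assms]] .

lemma vertices_hull_root_clique: "root_clique W \<Longrightarrow> vertices (convex hull W) = W"
  by (simp add: vertices_def extreme_point_of_convex_hull_affine_independent
      root_clique_affine_independent)

section \<open>Polytopes of type A and their dicing\<close>

text \<open>The condition \<open>i \<noteq> j\<close> matters because \<open>gap i i x = 0\<close>
  is always an integer.\<close>

lemma mem_lattice_hyperplanes_A_iff:
  "x \<in> \<Union>lattice_hyperplanes_A \<longleftrightarrow> x \<in> V_A \<and> (\<exists>i j. i \<noteq> j \<and> gap i j x \<in> \<int>)"
proof
  assume "x \<in> \<Union>lattice_hyperplanes_A"
  then obtain i j k where "x \<in> V_A" "i \<noteq> j" "gap i j x = of_int k"
    by (auto simp: lattice_hyperplanes_A_def root_system_A_def inner_root)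
  then show "x \<in> V_A \<and> (\<exists>i j. i \<noteq> j \<and> gap i j x \<in> \<int>)"
    by (metis Ints_of_int)
next
  assume "x \<in> V_A \<and> (\<exists>i j. i \<noteq> j \<and> gap i j x \<in> \<int>)"
  then obtain i j k where *: "x \<in> V_A" "i \<noteq> j" "gap i j x = of_int k"
    by (auto elim!: Ints_cases)
  let ?v = "axis i 1 - axis j 1 :: real ^ 'a"
  have "{y \<in> V_A. ?v \<bullet> y = of_int k} \<in> lattice_hyperplanes_A"
    using * by (auto simp: lattice_hyperplanes_A_def root_system_A_def)
  moreover have "x \<in> {y \<in> V_A. ?v \<bullet> y = of_int k}"
    using * by (simp add: inner_root)
  ultimately show "x \<in> \<Union>lattice_hyperplanes_A" by blast
qed

lemma gap_generic_not_int:
  "x \<in> V_A - \<Union>lattice_hyperplanes_A \<Longrightarrow> i \<noteq> j \<Longrightarrow> gap i j x \<notin> \<int>"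
  using mem_lattice_hyperplanes_A_iff by blast

lemma open_gap_less: "open {x. \<forall>i j. gap i j x - gap i j a < c}"
proof -
  have "open (\<Inter>i. \<Inter>j. {x. gap i j x - gap i j a < c})"
    by (intro open_INT ballI open_Collect_less continuous_intros) auto
  then show ?thesis by (simp add: Inter_eq)
qed

lemma closed_gap_le: "closed {x. \<forall>i j. gap i j x - gap i j a \<le> c}"
proof -
  have "closed (\<Inter>i. \<Inter>j. {x. gap i j x - gap i j a \<le> c})"
    by (intro closed_INT ballI closed_Collect_le continuous_intros)
  then show ?thesis by (simp add: Inter_eq)
qed

text \<open>For a fixed lattice point, the bounds \<open>< 1\<close> and \<open>\<le> 1\<close>
  agree off the hyperplanes, so its membership in the carrier is an open and closed condition on
  \<open>K\<close>.\<close>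

lemma carrier_constant_on_connected:
  assumes K: "connected K" "K \<subseteq> V_A - \<Union>lattice_hyperplanes_A" and xy: "x \<in> K" "y \<in> K"
  shows "carrier x = carrier y"
proof -
  have "a \<in> carrier x \<longleftrightarrow> a \<in> carrier y" if aL: "a \<in> lattice_A" for a
  proof -
    let ?T = "K \<inter> {z. \<forall>i j. gap i j z - gap i j a < 1}"
    have "gap i j z - gap i j a \<noteq> 1" if "z \<in> K" for z i j
    proof
      assume eq: "gap i j z - gap i j a = 1"
      then have "i \<noteq> j" by (auto simp: gap_self)
      moreover have "gap i j z = gap i j a + 1" using eq by simp
      then have "gap i j z \<in> \<int>" using aL by (simp add: lattice_A_iff)
      ultimately show False
        using that K(2) gap_generic_not_int by blast
    qed
    then have T: "?T = K \<inter> {z. \<forall>i j. gap i j z - gap i j a \<le> 1}"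
      unfolding less_le by blast
    have "closedin (top_of_set K) ?T"
      unfolding T using closed_gap_le by (rule closedin_closed_Int)
    moreover have "openin (top_of_set K) ?T"
      using open_gap_less by (rule openin_open_Int)
    ultimately have "?T = {} \<or> ?T = K"
      using K(1) unfolding connected_clopen by blast
    then show ?thesis
      using xy aL unfolding carrier_def by blast
  qed
  then show ?thesis unfolding carrier_def by blast
qed

section \<open>Facets and generic points of polytopes of type A\<close>

lemma polytope_type_A_facts:
  fixes P :: "(real ^ 'n) set"
  assumes "polytope_type_A P"
  shows "polytope P" "P \<subseteq> V_A" "affine hull P = V_A" "P \<noteq> {}"
proof -
  show "polytope P" and sub: "P \<subseteq> V_A"
    using assms by (auto simp: polytope_type_A_def lattice_polytope_def)
  have "affine hull P = affine hull (V_A :: (real ^ 'n) set)"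
    using assms aff_dim_eq_full_gen[OF sub] by (simp add: polytope_type_A_def)
  then show eq: "affine hull P = V_A"
    using subspace_imp_affine[OF subspace_V_A] by simp
  show "P \<noteq> {}"
    using eq subspace_0[OF subspace_V_A] by auto
qed

lemma polytope_type_A_facet:
  assumes "polytope_type_A P" "F facet_of P"
  obtains i j and w :: int where "affine hull F = {x \<in> V_A. gap i j x = of_int w}"
proof -
  from assms obtain v w where v: "v \<in> root_system_A"
    and *: "affine hull F = {x \<in> V_A. v \<bullet> x = of_int w}"
    unfolding polytope_type_A_def by blast
  from v obtain i j where "v = axis i 1 - axis j 1"
    by (auto simp: root_system_A_def)
  with * show thesis by (intro that) (auto simp: inner_root)
qed

text \<open>
  A lattice point near an interior point cannot lie beyond a facet, since the facet
  hyperplane would separate two values of a gap that differ by less than \<open>1\<close>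
  at an integer.
\<close>

lemma carrier_subset_polytope:
  assumes P: "polytope_type_A P" and x: "x \<in> P"
  shows "carrier x \<subseteq> P"
proof
  fix a assume a: "a \<in> carrier x"
  note facts = polytope_type_A_facts[OF P]
  have aV: "a \<in> V_A" using a lattice_A_subset by (auto simp: carrier_def)
  show "a \<in> P"
  proof (rule ccontr)
    assume na: "a \<notin> P"
    let ?N = "{z. \<forall>i j. gap i j z - gap i j a < 1}"
    \<comment> \<open>The strict bounds define an open set, so \<open>x\<close> can be replaced by a
      relative interior point \<open>p\<close> that still has \<open>a\<close> in its
      carrier.\<close>
    have "x \<in> closure (rel_interior P)"
      using x convex_closure_rel_interior[OF polytope_imp_convex[OF facts(1)]] closure_subset[of P] by auto
    moreover have "x \<in> ?N" using a by (auto simp: carrier_def)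
    ultimately obtain p where p: "p \<in> rel_interior P" "p \<in> ?N"
      using open_Int_closure_eq_empty[OF open_gap_less[of a 1], of "rel_interior P"] by blast
    have "p \<noteq> a" using p na rel_interior_subset by blast
    then have "a - p \<noteq> 0" by simp
    have "p + (a - p) \<in> affine hull P" using facts aV by simp
    then obtain d where d: "0 < d" "p + d *\<^sub>R (a - p) \<in> rel_frontier P"
      "\<And>e. 0 \<le> e \<Longrightarrow> e < d \<Longrightarrow> p + e *\<^sub>R (a - p) \<in> rel_interior P"
      using ray_to_rel_frontier[OF polytope_imp_bounded[OF facts(1)] p(1) _ \<open>a - p \<noteq> 0\<close>] by blast
    let ?y = "p + d *\<^sub>R (a - p)"
    have "rel_frontier P = \<Union>{F. F facet_of P}"
      using facts(1) by (intro rel_frontier_of_polyhedron polytope_imp_polyhedron)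
    then obtain F where F: "F facet_of P" "?y \<in> F" using d(2) by blast
    have "?y \<in> P" using F facet_of_imp_subset by blast
    have "d < 1"
    proof (rule ccontr)
      assume "\<not> d < 1"
      then consider "d = 1" | "1 < d" by linarith
      then show False
      proof cases
        case 1
        with \<open>?y \<in> P\<close> na show False by simp
      next
        case 2
        with d(3)[of 1] na rel_interior_subset show False by auto
      qed
    qed
    obtain i j and w :: int where *: "affine hull F = {x \<in> V_A. gap i j x = of_int w}"
      using polytope_type_A_facet[OF P F(1)] .
    have "?y \<in> affine hull F" using F(2) by (rule hull_inc)
    then have "gap i j ?y = of_int w"
      unfolding * by blast
    then have "gap i j p + d * (gap i j a - gap i j p) = of_int w"
      unfolding gap_add gap_scaleR gap_diff .
    \<comment> \<open>The left side is an integer and the right side is \<open>1 - d\<close> times a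
      number of absolute value below 1, so both vanish.\<close>
    then have eq: "gap i j a - of_int w = (1 - d) * (gap i j a - gap i j p)"
      by (simp add: algebra_simps)
    have "gap i j p - gap i j a < 1" "gap j i p - gap j i a < 1"
      using p(2) by blast+
    then have "\<bar>gap i j a - gap i j p\<bar> < 1"
      unfolding gap_def by linarith
    moreover have "(1 - d) * \<bar>gap i j a - gap i j p\<bar> \<le> \<bar>gap i j a - gap i j p\<bar>"
      using \<open>0 < d\<close> \<open>d < 1\<close> by (intro mult_left_le_one_le) auto
    ultimately have "(1 - d) * \<bar>gap i j a - gap i j p\<bar> < 1" by linarith
    then have "\<bar>gap i j a - of_int w\<bar> < 1"
      unfolding eq using \<open>d < 1\<close> by (simp add: abs_mult)
    moreover have "gap i j a - of_int w \<in> \<int>"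
      using a by (auto simp: carrier_def lattice_A_iff)
    ultimately have "gap i j a = of_int w" using Ints_abs_less_one by fastforce
    \<comment> \<open>Both \<open>a\<close> and the exit point lie on the facet hyperplane, which
      forces \<open>p\<close> onto it as well.\<close>
    with eq \<open>d < 1\<close> have "gap i j p = of_int w" by simp
    then have "p \<in> affine hull F"
      using * p(1) rel_interior_subset facts(2) by auto
    moreover have "affine hull F \<inter> rel_interior P = {}"
      using F(1) facts(1)
      by (intro affine_hull_face_of_disjoint_rel_interior polytope_imp_convex)
        (auto simp: facet_of_def)
    ultimately show False using p(1) by blast
  qed
qed

text \<open>From a nearby relative interior point, move in a direction with distinct coordinates: no
  root vanishes on it, so each root is integral for only countably many parameters.\<close>

lemma generic_points_dense:
  fixes P :: "(real ^ 'n) set"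
  assumes P: "polytope_type_A P" and x: "x \<in> P" and S: "open S" "x \<in> S"
  obtains y where "y \<in> P - \<Union>lattice_hyperplanes_A" "y \<in> S"
proof -
  note facts = polytope_type_A_facts[OF P]
  have "x \<in> closure (rel_interior P)"
    using x convex_closure_rel_interior[OF polytope_imp_convex[OF facts(1)]] closure_subset[of P] by auto
  then obtain p where p: "p \<in> rel_interior P" "p \<in> S"
    using S open_Int_closure_eq_empty[OF S(1), of "rel_interior P"] by blast
  obtain e1 where e1: "e1 > 0" "ball p e1 \<inter> V_A \<subseteq> P"
    using p(1) by (auto simp: mem_rel_interior_ball facts)
  obtain e2 where e2: "e2 > 0" "ball p e2 \<subseteq> S"
    using p(2) S(1) open_contains_ball by blast
  obtain f :: "'n \<Rightarrow> nat" where f: "inj f"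
    using finite_imp_inj_to_nat_seg[of "UNIV :: 'n set"] by auto
  obtain d where d: "d \<in> V_A" "\<And>i j. gap i j d = real (f i) - real (f j)"
    using exists_with_gaps[of "\<lambda>i. real (f i)"] by blast
  define B where "B = (\<Union>i. \<Union>j\<in>{j. i \<noteq> j}. {t. gap i j p + t * gap i j d \<in> \<int>})"
  have "countable {t. gap i j p + t * gap i j d \<in> \<int>}" if "i \<noteq> j" for i j
  proof -
    have "gap i j d \<noteq> 0" using f that by (auto simp: d inj_eq)
    then have "{t. gap i j p + t * gap i j d \<in> \<int>} \<subseteq> (\<lambda>k. (k - gap i j p) / gap i j d) ` \<int>"
      by (force simp: image_iff field_simps)
    then show ?thesis using countable_int countable_image countable_subset by blast
  qed
  then have "countable B" unfolding B_def by (intro countable_UN) auto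
  \<comment> \<open>Parameters below \<open>\<eta>\<close> stay in both balls; the summand 1 covers
    \<open>d = 0\<close>, which occurs for a single index.\<close>
  define \<eta> where "\<eta> = min e1 e2 / (norm d + 1)"
  have pos: "norm d + 1 > 0" by (smt (verit) norm_ge_zero)
  have "\<eta> > 0" using e1 e2 pos by (simp add: \<eta>_def)
  then have "\<not> {0<..<\<eta>} \<subseteq> B"
    using \<open>countable B\<close> countable_subset uncountable_open_interval by blast
  then obtain t where "t \<in> {0<..<\<eta>}" and tB: "t \<notin> B" by blast
  then have t: "0 < t" "t < \<eta>" by auto
  let ?y = "p + t *\<^sub>R d"
  have "t * norm d \<le> t * (norm d + 1)" using t by simp
  also have "\<dots> < min e1 e2"
    using t pos by (simp add: \<eta>_def field_simps)
  finally have dist: "dist p ?y < min e1 e2" using t by (simp add: dist_norm)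
  have pV: "p \<in> V_A" using p(1) rel_interior_subset facts(2) by blast
  have yV: "?y \<in> V_A"
    using pV d(1) subspace_V_A by (intro subspace_add subspace_scale) auto
  have "?y \<in> P" using e1(2) dist yV by auto
  moreover have "?y \<notin> \<Union>lattice_hyperplanes_A"
    using tB by (auto simp: mem_lattice_hyperplanes_A_iff B_def gap_add gap_scaleR simp del: Union_iff)
  moreover have "?y \<in> S" using e2(2) dist by auto
  ultimately show thesis by (intro that) auto
qed

section \<open>Cells of the dicing\<close>

text \<open>Carriers are constant on connected sets off the hyperplanes; conversely, a fibre of
  \<open>carrier\<close> is the relative interior of a simplex and hence connected.\<close>

lemma components_complement_hyperplanes_A:
  assumes P: "polytope_type_A P"
  shows "components (P - \<Union>lattice_hyperplanes_A) =
    (\<lambda>x. {y \<in> V_A. carrier y = carrier x}) ` (P - \<Union>lattice_hyperplanes_A)"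
    (is "components ?U = ?cell ` ?U")
proof -
  note facts = polytope_type_A_facts[OF P]
  have cell: "connected_component_set ?U x = ?cell x" if x: "x \<in> ?U" for x
  proof (rule connected_component_unique)
    show "x \<in> ?cell x" using x facts by auto
    show "connected (?cell x)"
      using rel_interior_hull_root_clique[OF root_clique_carrier carrier_nonempty, of x]
      by (metis convex_connected convex_convex_hull convex_rel_interior)
    show "?cell x \<subseteq> ?U"
    proof
      fix y assume y: "y \<in> ?cell x"
      have "convex hull (carrier x) \<subseteq> P"
        using carrier_subset_polytope[OF P] x polytope_imp_convex[OF facts(1)]
        by (intro hull_minimal) auto
      with y in_hull_carrier[of y] have "y \<in> P" by auto
      \<comment> \<open>An integral gap at \<open>y\<close> would be shared by its carrier, and so
        by the generic point \<open>x\<close> with the same carrier.\<close>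
      moreover have "gap i j y \<notin> \<int>" if "i \<noteq> j" for i j
      proof
        assume int: "gap i j y \<in> \<int>"
        have "convex {z. gap i j z = gap i j y}"
          by (simp add: convex_def gap_add gap_scaleR flip: distrib_right)
        then have "convex hull (carrier x) \<subseteq> {z. gap i j z = gap i j y}"
          using gap_carrier_int[OF _ int] y by (intro hull_minimal) auto
        then have "gap i j x = gap i j y"
          using in_hull_carrier[of x] x facts(2) by auto
        with int that x facts(2) show False
          using gap_generic_not_int[of x i j] by auto
      qed
      ultimately show "y \<in> ?U"
        by (auto simp: mem_lattice_hyperplanes_A_iff simp del: Union_iff)
    qed
    show "K \<subseteq> ?cell x" if "x \<in> K" "K \<subseteq> ?U" "connected K" for K
      using carrier_constant_on_connected[OF that(3) _ _ that(1)] that(2) facts(2) by blast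
  qed
  show ?thesis
    unfolding components_def using cell by (rule image_cong[OF refl])
qed

text \<open>The maximal cells are the hulls of carriers of generic points. A nonempty clique in
  \<open>P\<close> is the carrier of a point of \<open>P\<close>, and a small move to a generic
  point can only enlarge the carrier.\<close>

lemma lattice_dicing_A_eq:
  assumes P: "polytope_type_A P"
  shows "lattice_dicing_A P = {convex hull W | W. root_clique W \<and> W \<subseteq> P}"
proof -
  let ?U = "P - \<Union>lattice_hyperplanes_A"
  have closure: "closure {y \<in> V_A. carrier y = carrier x} = convex hull (carrier x)" for x
  proof -
    have "compact (convex hull (carrier x))"
      using root_clique_finite[OF root_clique_carrier]
      by (intro compact_convex_hull finite_imp_compact)
    then show ?thesis
      using convex_closure_rel_interior[OF convex_convex_hull, of "carrier x"]
        rel_interior_hull_root_clique[OF root_clique_carrier carrier_nonempty, of x]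
      by (simp add: compact_imp_closed closure_closed)
  qed
  have "lattice_dicing_A P = {F. \<exists>x\<in>?U. F face_of convex hull (carrier x)}"
    unfolding lattice_dicing_A_def slicing_def components_complement_hyperplanes_A[OF P]
    by (simp add: closure)
  also have "\<dots> = {convex hull W | W. \<exists>x\<in>?U. W \<subseteq> carrier x}"
    unfolding face_of_hull_root_clique_iff[OF root_clique_carrier] by blast
  also have "\<dots> = {convex hull W | W. root_clique W \<and> W \<subseteq> P}"
  proof -
    have "(\<exists>x\<in>?U. W \<subseteq> carrier x) \<longleftrightarrow> root_clique W \<and> W \<subseteq> P" for W
    proof
      assume "\<exists>x\<in>?U. W \<subseteq> carrier x"
      then show "root_clique W \<and> W \<subseteq> P"
        using carrier_subset_polytope[OF P] root_clique_subset[OF root_clique_carrier] by blast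
    next
      assume W: "root_clique W \<and> W \<subseteq> P"
      obtain p where p: "p \<in> P" "W \<subseteq> carrier p"
      proof (cases "W = {}")
        case True
        with that polytope_type_A_facts(4)[OF P] show thesis by blast
      next
        case False
        then obtain p where "p \<in> convex hull W" "carrier p = W"
          using root_clique_is_carrier W by blast
        moreover have "convex hull W \<subseteq> P"
          using W polytope_imp_convex[OF polytope_type_A_facts(1)[OF P]] by (simp add: hull_minimal)
        ultimately show thesis using that by blast
      qed
      \<comment> \<open>The strict bounds at the points of \<open>W\<close> survive a small move of
        \<open>p\<close>.\<close>
      let ?S = "\<Inter>a\<in>W. {z. \<forall>i j. gap i j z - gap i j a < 1}"
      have "open ?S"
        using W root_clique_finite by (intro open_INT ballI open_gap_less) auto
      moreover have "p \<in> ?S" using p by (auto simp: carrier_def)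
      ultimately obtain y where "y \<in> ?U" "y \<in> ?S"
        using generic_points_dense[OF P p(1)] by blast
      then have "W \<subseteq> carrier y"
        using W by (auto simp: carrier_def root_clique_def)
      with \<open>y \<in> ?U\<close> show "\<exists>x\<in>?U. W \<subseteq> carrier x" by blast
    qed
    then show ?thesis by simp
  qed
  finally show ?thesis .
qed

section \<open>The triangulation\<close>

text \<open>A gap involves two coordinates, so lattice points at distance below 1/2 have gaps
  differing by less than 1 and coincide; the lattice is uniformly discrete.\<close>

lemma finite_lattice_A_Int:
  assumes "bounded (S :: (real ^ 'n) set)"
  shows "finite (S \<inter> lattice_A)"
proof -
  have "x = y" if xy: "x \<in> lattice_A" "y \<in> lattice_A" and d: "dist x y < 1 / 2" for x y :: "real ^ 'n"
  proof (rule gap_zero_imp_eq)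
    show "x \<in> V_A" "y \<in> V_A" using xy lattice_A_subset by auto
    fix i j
    have "\<bar>(x - y) $ k\<bar> < 1 / 2" for k
      using component_le_norm_cart[of "x - y" k] d by (simp add: dist_norm)
    from this[of i] this[of j] have "\<bar>gap i j x - gap i j y\<bar> < 1"
      unfolding gap_def vector_minus_component by linarith
    moreover have "gap i j x - gap i j y \<in> \<int>" using xy by (auto simp: lattice_A_iff)
    ultimately have "gap i j x - gap i j y = 0" by (intro Ints_abs_less_one)
    then show "gap i j x = gap i j y" by simp
  qed
  then have "uniform_discrete (S \<inter> lattice_A)"
    unfolding uniform_discrete_def by (metis IntD2 half_gt_zero zero_less_one)
  moreover have "bounded (S \<inter> lattice_A)" using assms by (rule bounded_subset) auto
  ultimately show ?thesis using uniform_discrete_finite_iff[of "S \<inter> lattice_A"] by simp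
qed

lemma lattice_polytope_hull_root_clique:
  "root_clique W \<Longrightarrow> lattice_polytope lattice_A (convex hull W)"
  using root_clique_finite
  by (auto simp: lattice_polytope_def vertices_hull_root_clique polytope_def root_clique_def)

text \<open>A point of \<open>V_A\<close> lies in both simplices when its carrier is contained in
  both \<open>W\<close> and \<open>U\<close>.\<close>

lemma root_clique_hull_Int:
  assumes "root_clique W" "root_clique U"
  shows "convex hull W \<inter> convex hull U = convex hull (W \<inter> U)"
  using assms root_clique_subset[of W "W \<inter> U"] by (auto simp: mem_hull_root_clique_iff)

lemma lattice_triangulation_dicing_A:
  assumes P: "polytope_type_A P"
  shows "lattice_triangulation lattice_A P (lattice_dicing_A P)"
  unfolding lattice_triangulation_def
proof (intro conjI)
  note facts = polytope_type_A_facts[OF P]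
  have dicing: "lattice_dicing_A P = (hull) convex ` {W. root_clique W \<and> W \<subseteq> P}"
    by (auto simp: lattice_dicing_A_eq[OF P])
  show "simplicial_complex (lattice_dicing_A P)"
    unfolding simplicial_complex_def
  proof (intro conjI allI ballI impI)
    have "{W. root_clique W \<and> W \<subseteq> P} \<subseteq> Pow (P \<inter> lattice_A)"
      by (auto simp: root_clique_def)
    then show "finite (lattice_dicing_A P)"
      unfolding dicing using finite_lattice_A_Int[OF polytope_imp_bounded[OF facts(1)]]
      by (intro finite_imageI) (metis finite_Pow_iff finite_subset)
  next
    fix S assume "S \<in> lattice_dicing_A P"
    then obtain W where W: "root_clique W" "S = convex hull W" by (auto simp: dicing)
    \<comment> \<open>The empty clique gives the empty simplex, of dimension -1.\<close>
    have "int (card W) - 1 simplex S"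
      unfolding simplex_def using W root_clique_affine_independent by auto
    then show "\<exists>n. n simplex S" ..
  next
    fix F S assume "S \<in> lattice_dicing_A P \<and> F face_of S"
    then obtain W U where "root_clique W" "W \<subseteq> P" "U \<subseteq> W" "F = convex hull U"
      by (auto simp: dicing face_of_hull_root_clique_iff)
    then show "F \<in> lattice_dicing_A P"
      unfolding dicing using root_clique_subset[of W U] by (intro image_eqI[of _ _ U]) auto
  next
    fix S S' assume "S \<in> lattice_dicing_A P \<and> S' \<in> lattice_dicing_A P"
    then obtain W U where "root_clique W" "root_clique U" "S = convex hull W" "S' = convex hull U"
      by (auto simp: dicing)
    then show "S \<inter> S' face_of S"
      using root_clique_hull_Int[of W U] face_of_hull_root_clique_iff[of W] by auto
  qed
  show "\<Union>(lattice_dicing_A P) = P"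
  proof
    have "convex hull W \<subseteq> P" if "W \<subseteq> P" for W
      using that polytope_imp_convex[OF facts(1)] by (rule hull_minimal)
    then show "\<Union>(lattice_dicing_A P) \<subseteq> P"
      unfolding dicing by blast
    show "P \<subseteq> \<Union>(lattice_dicing_A P)"
    proof
      fix x assume x: "x \<in> P"
      then have "x \<in> convex hull (carrier x)" using facts(2) in_hull_carrier by blast
      moreover have "convex hull (carrier x) \<in> lattice_dicing_A P"
        using root_clique_carrier carrier_subset_polytope[OF P x] by (auto simp: dicing)
      ultimately show "x \<in> \<Union>(lattice_dicing_A P)" by blast
    qed
  qed
  show "\<forall>S\<in>lattice_dicing_A P. lattice_polytope lattice_A S"
    using lattice_polytope_hull_root_clique by (auto simp: dicing)
qed

section \<open>Unimodularity\<close>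

lemma lattice_A_int_combination:
  assumes "finite B" "B \<subseteq> lattice_A"
  shows "(\<Sum>b\<in>B. of_int (c b) *\<^sub>R b) \<in> lattice_A"
  unfolding lattice_A_iff
proof (intro conjI allI)
  show "(\<Sum>b\<in>B. of_int (c b) *\<^sub>R b) \<in> V_A"
    using assms lattice_A_subset
    by (intro subspace_sum subspace_V_A subspace_scale) auto
  show "gap i j (\<Sum>b\<in>B. of_int (c b) *\<^sub>R b) \<in> \<int>" for i j
    using assms unfolding gap_sum gap_scaleR
    by (intro Ints_sum Ints_mult) (auto simp: lattice_A_iff)
qed

text \<open>Among the edges at \<open>v\<close>, the root isolating \<open>u\<close> is -1 on
  \<open>u - v\<close> and 0 on the others. Up to sign it reads off a coefficient, which is
  therefore an integer for a lattice point.\<close>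

lemma unimodular_simplex_hull_root_clique:
  assumes W: "root_clique W"
  shows "unimodular_simplex lattice_A (convex hull W)"
  unfolding unimodular_simplex_def Let_def vertices_hull_root_clique[OF W]
proof (intro conjI ballI)
  show "lattice_polytope lattice_A (convex hull W)"
    using W by (rule lattice_polytope_hull_root_clique)
  fix v assume v: "v \<in> W"
  define E where "E = {u - v | u. u \<in> W - {v}}"
  have fin: "finite E" using root_clique_finite[OF W] by (simp add: E_def)
  have "a - v \<in> lattice_A" if "a \<in> W" for a
    using W v that subspace_V_A subspace_diff
    by (auto simp: root_clique_def lattice_A_iff gap_diff subset_iff)
  then have EL: "E \<subseteq> lattice_A" by (auto simp: E_def)
  have "E = (\<lambda>x. - v + x) ` (W - {v})" by (auto simp: E_def)
  then have indep: "independent E"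
    using root_clique_affine_independent[OF W] affine_dependent_iff_dependent2[OF v] by simp
  have "lattice_A \<inter> span E = {\<Sum>b\<in>E. real_of_int (c b) *\<^sub>R b | c. True}" (is "?l = ?r")
  proof
    have "(\<Sum>b\<in>E. real_of_int (c b) *\<^sub>R b) \<in> span E" for c
      by (intro span_sum span_scale span_base)
    then show "?r \<subseteq> ?l"
      using lattice_A_int_combination[OF fin EL] by blast
    show "?l \<subseteq> ?r"
    proof
      fix y assume y: "y \<in> ?l"
      then obtain q where q: "y = (\<Sum>b\<in>E. q b *\<^sub>R b)"
        by (auto simp: span_finite[OF fin])
      have "q e \<in> \<int>" if e: "e \<in> E" for e
      proof -
        obtain u where u: "e = u - v" "u \<in> W" "u \<noteq> v" using e by (auto simp: E_def)
        obtain i j where ij: "\<And>b. b \<in> W \<Longrightarrow> b \<noteq> u \<Longrightarrow> gap i j b = gap i j u + 1"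
          using root_clique_coordinate[OF W u(2)] by blast
        have "q b * gap i j b = (if b = e then - q e else 0)" if b: "b \<in> E" for b
        proof -
          obtain w where w: "b = w - v" "w \<in> W" "w \<noteq> v" using b by (auto simp: E_def)
          show ?thesis using ij[of v] ij[of w] u v w by (auto simp: gap_diff)
        qed
        then have "gap i j y = (\<Sum>b\<in>E. if b = e then - q e else 0)"
          unfolding q gap_sum gap_scaleR by (rule sum.cong[OF refl])
        then have "gap i j y = - q e" using e fin by simp
        moreover have "gap i j y \<in> \<int>" using y by (simp add: lattice_A_iff)
        ultimately show ?thesis by (metis Ints_minus minus_minus)
      qed
      then have "y = (\<Sum>b\<in>E. real_of_int \<lfloor>q b\<rfloor> *\<^sub>R b)"
        unfolding q by (intro sum.cong) (auto elim!: Ints_cases)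
      then show "y \<in> ?r" by (auto intro!: exI[of _ "\<lambda>b. \<lfloor>q b\<rfloor>"])
    qed
  qed
  with indep show "lattice_basis (lattice_A \<inter> span {u - v |u. u \<in> W - {v}}) {u - v |u. u \<in> W - {v}}"
    unfolding lattice_basis_def E_def by blast
qed

section \<open>Flagness\<close>

text \<open>Among lattice points, being a clique is a condition on pairs: a non-face contains a
  violating pair, and minimality leaves nothing else.\<close>

lemma flag_dicing_A:
  assumes P: "polytope_type_A P"
  shows "flag (lattice_dicing_A P)"
  unfolding flag_def
proof (intro allI impI)
  fix W assume W: "minimal_nonface (lattice_dicing_A P) W"
  have dicing: "lattice_dicing_A P = (hull) convex ` {W. root_clique W \<and> W \<subseteq> P}"
    by (auto simp: lattice_dicing_A_eq[OF P])
  have "vertices ` lattice_dicing_A P = (\<lambda>W. W) ` {W. root_clique W \<and> W \<subseteq> P}"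
    unfolding dicing image_image by (rule image_cong) (auto simp: vertices_hull_root_clique)
  then have faces: "vertices ` lattice_dicing_A P = {W. root_clique W \<and> W \<subseteq> P}" by simp
  have "complex_vertices (lattice_dicing_A P) \<subseteq> P \<inter> lattice_A"
    unfolding complex_vertices_def faces root_clique_def by blast
  then have sub: "W \<subseteq> P" "W \<subseteq> lattice_A"
    using W unfolding minimal_nonface_def by blast+
  have "\<not> root_clique W"
    using W sub(1) unfolding minimal_nonface_def faces by blast
  then obtain a b i j where ab: "a \<in> W" "b \<in> W" "\<not> gap i j a - gap i j b \<le> 1"
    using sub(2) unfolding root_clique_def by blast
  then have "\<not> root_clique {a, b}" unfolding root_clique_def by blast
  then have "\<not> {a, b} \<subset> W"
    using W unfolding minimal_nonface_def faces by blast
  then have "W = {a, b}" using ab by blast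
  moreover have "a \<noteq> b" using ab by auto
  ultimately show "card W = 2" by simp
qed

section \<open>Regularity\<close>

text \<open>On \<open>V_A\<close> this is 2n times the squared Euclidean norm, so the regular
  subdivision it induces is the Delaunay one.\<close>

definition gap_energy :: "real ^ 'n \<Rightarrow> real" where
  "gap_energy a = (\<Sum>p\<in>UNIV. (gap (fst p) (snd p) a)\<^sup>2)"

text \<open>On a clique a root takes one integer value or two consecutive ones. The line with slope
  \<open>m\<close> and intercept \<open>c\<close> is the tangent of the parabola at the single
  value, or the secant through the two; the parabola is below that secant only strictly between
  them, where there is no integer.\<close>

lemma root_clique_gap_support:
  assumes W: "root_clique W" and "W \<noteq> {}"
  shows "\<exists>m c. \<forall>a\<in>lattice_A. 0 \<le> (gap i j a)\<^sup>2 - m * gap i j a - c \<and>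
    ((gap i j a)\<^sup>2 - m * gap i j a - c = 0 \<longleftrightarrow> gap i j a \<in> gap i j ` W)"
proof (cases "\<exists>b0\<in>W. \<exists>b1\<in>W. gap i j b0 < gap i j b1")
  case True
  then obtain b0 b1 where b: "b0 \<in> W" "b1 \<in> W" "gap i j b0 < gap i j b1" by blast
  define t where "t = gap i j b0"
  have int: "gap i j a - t \<in> \<int>" if "a \<in> lattice_A" for a
    using that b W by (auto simp: t_def root_clique_def lattice_A_iff subset_iff)
  have dich: "gap i j a - t \<le> 0 \<or> gap i j a - t \<ge> 1" if "a \<in> lattice_A" for a
    using int[OF that] by (auto elim!: Ints_cases)
  have b1: "gap i j b1 = t + 1"
  proof -
    have "gap i j b1 - t \<le> 1" using W b by (auto simp: t_def root_clique_def)
    moreover have "gap i j b1 - t \<ge> 1"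
      using dich[of b1] b W by (auto simp: t_def root_clique_def)
    ultimately show ?thesis by simp
  qed
  have img: "gap i j ` W = {t, t + 1}"
  proof
    show "{t, t + 1} \<subseteq> gap i j ` W" using b b1 by (auto simp: t_def) (metis imageI)
    have "gap i j w = t \<or> gap i j w = t + 1" if w: "w \<in> W" for w
    proof -
      have "gap i j w - t \<le> 1" "gap i j b1 - gap i j w \<le> 1"
        using W b w by (auto simp: t_def root_clique_def)
      then show ?thesis using dich[of w] b1 w W by (auto simp: root_clique_def)
    qed
    then show "gap i j ` W \<subseteq> {t, t + 1}" by auto
  qed
  \<comment> \<open>The secant of the parabola through \<open>t\<close> and \<open>t + 1\<close> has
    slope \<open>2 * t + 1\<close> and intercept \<open>- t * (t + 1)\<close>.\<close>
  have eq: "x\<^sup>2 - (2 * t + 1) * x - (- t * (t + 1)) = (x - t) * (x - t - 1)" for x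
    by (simp add: power2_eq_square algebra_simps)
  have nonneg: "0 \<le> (gap i j a - t) * (gap i j a - t - 1)" if "a \<in> lattice_A" for a
    using dich[OF that] by (auto simp: zero_le_mult_iff)
  have "(x - t) * (x - t - 1) = 0 \<longleftrightarrow> x \<in> {t, t + 1}" for x
    by auto
  with nonneg have "\<forall>a\<in>lattice_A. 0 \<le> (gap i j a - t) * (gap i j a - t - 1) \<and>
      ((gap i j a - t) * (gap i j a - t - 1) = 0 \<longleftrightarrow> gap i j a \<in> gap i j ` W)"
    unfolding img by blast
  then show ?thesis unfolding eq[symmetric] by (intro exI)
next
  case False
  obtain b where b: "b \<in> W" using assms by blast
  define t where "t = gap i j b"
  have img: "gap i j ` W = {t}"
    using False b unfolding t_def by (auto simp: not_less intro: order.antisym)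
  have eq: "x\<^sup>2 - (2 * t) * x - (- t\<^sup>2) = (x - t)\<^sup>2" for x
    by (simp add: power2_eq_square algebra_simps)
  have "\<forall>a\<in>lattice_A. 0 \<le> (gap i j a - t)\<^sup>2 \<and>
      ((gap i j a - t)\<^sup>2 = 0 \<longleftrightarrow> gap i j a \<in> gap i j ` W)"
    unfolding img by simp
  then show ?thesis unfolding eq[symmetric] by (intro exI)
qed

text \<open>Summing the supports of all roots, equality at \<open>a\<close> means that every gap of
  \<open>a\<close> is attained on \<open>W\<close>. Then \<open>a\<close> can be joined to the
  clique, and if it were new, its isolating root would have a value at \<open>a\<close> that is not
  attained on \<open>W\<close>.\<close>

lemma root_clique_support:
  fixes W :: "(real ^ 'n) set"
  assumes W: "root_clique W" and ne: "W \<noteq> {}"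
  shows "\<exists>u b. \<forall>a\<in>lattice_A. b \<le> u \<bullet> a + gap_energy a \<and>
    (u \<bullet> a + gap_energy a = b \<longleftrightarrow> a \<in> W)"
proof -
  have "\<forall>p :: 'n \<times> 'n. \<exists>m c. \<forall>a\<in>lattice_A.
      0 \<le> (gap (fst p) (snd p) a)\<^sup>2 - m * gap (fst p) (snd p) a - c \<and>
      ((gap (fst p) (snd p) a)\<^sup>2 - m * gap (fst p) (snd p) a - c = 0 \<longleftrightarrow>
        gap (fst p) (snd p) a \<in> gap (fst p) (snd p) ` W)"
    using root_clique_gap_support[OF W ne] by blast
  then obtain m c where mc: "\<And>p a. a \<in> lattice_A \<Longrightarrow>
      0 \<le> (gap (fst p) (snd p) a)\<^sup>2 - m p * gap (fst p) (snd p) a - c p \<and>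
      ((gap (fst p) (snd p) a)\<^sup>2 - m p * gap (fst p) (snd p) a - c p = 0 \<longleftrightarrow>
        gap (fst p) (snd p) a \<in> gap (fst p) (snd p) ` W)"
    by metis
  define \<phi> where "\<phi> a p = (gap (fst p) (snd p) a)\<^sup>2 - m p * gap (fst p) (snd p) a - c p"
    for a :: "real ^ 'n" and p :: "'n \<times> 'n"
  \<comment> \<open>Collecting slopes in \<open>u\<close> and intercepts in \<open>b\<close> turns
    the sum of the nonnegative terms into the excess over the bound \<open>b\<close>.\<close>
  define u where "u = - (\<Sum>p\<in>UNIV. m p *\<^sub>R (axis (fst p) 1 - axis (snd p) 1 :: real ^ 'n))"
  define b where "b = sum c UNIV"
  have sum: "u \<bullet> a + gap_energy a - b = sum (\<phi> a) UNIV" for a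
    by (simp add: u_def b_def \<phi>_def gap_energy_def inner_sum_left inner_root sum_subtractf
        flip: inner_diff_left)
  have \<phi>_nonneg: "0 \<le> \<phi> a p" if "a \<in> lattice_A" for a p
    using mc[OF that] unfolding \<phi>_def by blast
  have \<phi>_eq_0: "\<phi> a p = 0 \<longleftrightarrow> gap (fst p) (snd p) a \<in> gap (fst p) (snd p) ` W"
    if "a \<in> lattice_A" for a p
    using mc[OF that] unfolding \<phi>_def by blast
  have W_iff: "(\<forall>p. \<phi> a p = 0) \<longleftrightarrow> a \<in> W" if a: "a \<in> lattice_A" for a
  proof
    assume "a \<in> W"
    then show "\<forall>p. \<phi> a p = 0" unfolding \<phi>_eq_0[OF a] by blast
  next
    assume "\<forall>p. \<phi> a p = 0"
    then have in_img: "gap i j a \<in> gap i j ` W" for i j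
      using \<phi>_eq_0[OF a, of "(i, j)"] by simp
    have "gap i j a - gap i j w \<le> 1" if w: "w \<in> W" for i j w
    proof -
      obtain w' where "w' \<in> W" "gap i j a = gap i j w'" using in_img[of i j] by blast
      with w W show ?thesis by (simp add: root_clique_def)
    qed
    then have "root_clique (insert a W)" using W a unfolding root_clique_insert by blast
    then obtain i j where ij: "\<And>w. w \<in> insert a W \<Longrightarrow> w \<noteq> a \<Longrightarrow> gap i j w = gap i j a + 1"
      using root_clique_coordinate by blast
    show "a \<in> W"
    proof (rule ccontr)
      assume "a \<notin> W"
      moreover obtain w where w: "w \<in> W" "gap i j a = gap i j w" using in_img[of i j] by blast
      ultimately have "w \<noteq> a" by blast
      with ij[of w] w show False by simp
    qed
  qed
  have "b \<le> u \<bullet> a + gap_energy a \<and> (u \<bullet> a + gap_energy a = b \<longleftrightarrow> a \<in> W)"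
    if a: "a \<in> lattice_A" for a
  proof
    have "0 \<le> sum (\<phi> a) UNIV" using \<phi>_nonneg[OF a] by (simp add: sum_nonneg)
    then show "b \<le> u \<bullet> a + gap_energy a" using sum[of a] by linarith
    have "u \<bullet> a + gap_energy a = b \<longleftrightarrow> sum (\<phi> a) UNIV = 0" using sum[of a] by linarith
    also have "\<dots> \<longleftrightarrow> (\<forall>p. \<phi> a p = 0)"
      using \<phi>_nonneg[OF a] by (simp add: sum_nonneg_eq_0_iff)
    finally show "u \<bullet> a + gap_energy a = b \<longleftrightarrow> a \<in> W" using W_iff[OF a] by simp
  qed
  then show ?thesis by blast
qed

section \<open>Lower faces\<close>

text \<open>The hyperplane cuts out a face, and a face of the hull of a finite set is the hull of
  some of its points.\<close>

lemma convex_hull_Int_supporting_hyperplane: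
  fixes S :: "'a::euclidean_space set"
  assumes "finite S" and ge: "\<And>x. x \<in> S \<Longrightarrow> b \<le> u \<bullet> x"
  shows "convex hull S \<inter> {x. u \<bullet> x = b} = convex hull (S \<inter> {x. u \<bullet> x = b})"
proof
  have "convex hull S \<subseteq> {x. u \<bullet> x \<ge> b}"
    using ge by (intro hull_minimal convex_halfspace_ge) auto
  then have "(convex hull S \<inter> {x. u \<bullet> x = b}) face_of (convex hull S)"
    by (intro face_of_Int_supporting_hyperplane_ge convex_convex_hull) auto
  then obtain S' where S': "S' \<subseteq> S" "convex hull S \<inter> {x. u \<bullet> x = b} = convex hull S'"
    using face_of_convex_hull_subset finite_imp_compact[OF assms(1)] by blast
  then have "S' \<subseteq> S \<inter> {x. u \<bullet> x = b}" using hull_subset[of S' convex] by blast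
  then show "convex hull S \<inter> {x. u \<bullet> x = b} \<subseteq> convex hull (S \<inter> {x. u \<bullet> x = b})"
    using S'(2) hull_mono by metis
  have "convex (convex hull S \<inter> {x. u \<bullet> x = b})"
    by (intro convex_Int convex_convex_hull convex_hyperplane)
  then show "convex hull (S \<inter> {x. u \<bullet> x = b}) \<subseteq> convex hull S \<inter> {x. u \<bullet> x = b}"
    by (intro hull_minimal) (auto intro: hull_inc)
qed

text \<open>A lower face is spanned by the lifted points at which the bound is attained, and the
  projection commutes with hulls.\<close>

lemma regular_subdivision_eq:
  assumes fin: "finite (P \<inter> L)"
  shows "regular_subdivision L P \<omega> =
    {convex hull {a \<in> P \<inter> L. u \<bullet> a + \<omega> a = b} | u b. \<forall>a\<in>P \<inter> L. b \<le> u \<bullet> a + \<omega> a}"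
proof -
  let ?S = "(\<lambda>a. (a, \<omega> a)) ` (P \<inter> L)"
  have lift: "lifted_polytope L P \<omega> = convex hull ?S"
    unfolding lifted_polytope_def by (rule arg_cong[of _ _ "(hull) convex"]) auto
  have half: "convex hull ?S \<subseteq> {z. b \<le> (u, 1) \<bullet> z} \<longleftrightarrow> (\<forall>a\<in>P \<inter> L. b \<le> u \<bullet> a + \<omega> a)" for u b
  proof -
    have "convex {z. b \<le> (u, 1) \<bullet> z}" using convex_halfspace_ge[of b "(u, 1)"] by simp
    then have "convex hull ?S \<subseteq> {z. b \<le> (u, 1) \<bullet> z} \<longleftrightarrow> ?S \<subseteq> {z. b \<le> (u, 1) \<bullet> z}"
      by (rule subset_hull)
    then show ?thesis by auto
  qed
  have face: "fst ` (convex hull ?S \<inter> {z. (u, 1) \<bullet> z = b}) = convex hull {a \<in> P \<inter> L. u \<bullet> a + \<omega> a = b}"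
    if "\<forall>a\<in>P \<inter> L. b \<le> u \<bullet> a + \<omega> a" for u b
  proof -
    have "convex hull ?S \<inter> {z. (u, 1) \<bullet> z = b} = convex hull (?S \<inter> {z. (u, 1) \<bullet> z = b})"
      using fin that by (intro convex_hull_Int_supporting_hyperplane) auto
    also have "fst ` \<dots> = convex hull (fst ` (?S \<inter> {z. (u, 1) \<bullet> z = b}))"
      by (rule convex_hull_linear_image[OF linear_fst])
    also have "fst ` (?S \<inter> {z. (u, 1) \<bullet> z = b}) = {a \<in> P \<inter> L. u \<bullet> a + \<omega> a = b}"
      by force
    finally show ?thesis .
  qed
  have "regular_subdivision L P \<omega> =
      {fst ` (convex hull ?S \<inter> {z. (u, 1) \<bullet> z = b}) | u b. \<forall>a\<in>P \<inter> L. b \<le> u \<bullet> a + \<omega> a}"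
    unfolding regular_subdivision_def lower_face_def lift half by blast
  also have "\<dots> = {convex hull {a \<in> P \<inter> L. u \<bullet> a + \<omega> a = b} | u b. \<forall>a\<in>P \<inter> L. b \<le> u \<bullet> a + \<omega> a}"
    by (intro Collect_cong ex_cong1 rev_conj_cong refl) (simp add: face)
  finally show ?thesis .
qed

text \<open>
  Comparing a supporting functional at a lower face with the one at the carrier of its
  barycentre shows that both have the same height there, so the vertices of the face lie
  in the carrier.
\<close>

lemma lower_face_root_clique:
  assumes P: "polytope_type_A P"
    and supp: "\<And>a. a \<in> P \<inter> lattice_A \<Longrightarrow> b \<le> u \<bullet> a + gap_energy a"
  shows "root_clique {a \<in> P \<inter> lattice_A. u \<bullet> a + gap_energy a = b}" (is "root_clique ?T")
proof (cases "?T = {}")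
  case True
  then show ?thesis by (simp only:) (simp add: root_clique_def)
next
  case False
  note facts = polytope_type_A_facts[OF P]
  have fin: "finite ?T"
    using finite_lattice_A_Int[OF polytope_imp_bounded[OF facts(1)]]
    by (rule finite_subset[rotated]) auto
  define \<mu> where "\<mu> = 1 / real (card ?T)"
  have \<mu>: "\<mu> > 0" "(\<Sum>a\<in>?T. \<mu>) = 1"
    using fin False by (auto simp: \<mu>_def card_gt_0_iff)
  define x where "x = (\<Sum>a\<in>?T. \<mu> *\<^sub>R a)"
  have "x \<in> convex hull ?T"
    unfolding convex_hull_finite[OF fin] x_def using \<mu> by (auto intro!: exI[of _ "\<lambda>_. \<mu>"])
  moreover have "convex hull ?T \<subseteq> P"
    using polytope_imp_convex[OF facts(1)] by (intro hull_minimal) auto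
  ultimately have xP: "x \<in> P" by blast
  let ?C = "carrier x"
  have C: "?C \<subseteq> P \<inter> lattice_A"
    using carrier_subset_polytope[OF P xP] root_clique_carrier[of x] unfolding root_clique_def by blast
  have finC: "finite ?C" by (rule root_clique_finite[OF root_clique_carrier])
  have "x \<in> convex hull ?C" using in_hull_carrier xP facts(2) by blast
  then obtain c where c: "\<And>a. a \<in> ?C \<Longrightarrow> 0 \<le> c a" "sum c ?C = 1" "(\<Sum>a\<in>?C. c a *\<^sub>R a) = x"
    unfolding convex_hull_finite[OF finC] by blast
  obtain u' b' where support: "\<forall>a\<in>lattice_A. b' \<le> u' \<bullet> a + gap_energy a \<and>
      (u' \<bullet> a + gap_energy a = b' \<longleftrightarrow> a \<in> ?C)"
    using root_clique_support[OF root_clique_carrier[of x] carrier_nonempty[of x]] by blast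
  have supp': "b' \<le> u' \<bullet> a + gap_energy a"
    and tight': "u' \<bullet> a + gap_energy a = b' \<longleftrightarrow> a \<in> ?C" if "a \<in> lattice_A" for a
    using support that by blast+
  \<comment> \<open>For weights representing \<open>x\<close>, the weighted excess depends on the
    weights only through the mean energy.\<close>
  have expand: "(\<Sum>a\<in>A. d a * (w \<bullet> a + gap_energy a - k)) = w \<bullet> x + (\<Sum>a\<in>A. d a * gap_energy a) - k"
    if "sum d A = 1" "(\<Sum>a\<in>A. d a *\<^sub>R a) = x" for A d w k
  proof -
    have "w \<bullet> x = (\<Sum>a\<in>A. d a * (w \<bullet> a))"
      using that(2) by (auto simp: inner_sum_right)
    moreover have "(\<Sum>a\<in>A. d a * k) = k"
      using that(1) by (simp flip: sum_distrib_right)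
    ultimately show ?thesis
      by (simp add: algebra_simps sum.distrib sum_subtractf)
  qed
  \<comment> \<open>Of the four sums, the first two show that the mean energy over \<open>?T\<close>
    is at most that over \<open>?C\<close>, the last two the reverse.\<close>
  have "(\<Sum>a\<in>?T. \<mu> * (u \<bullet> a + gap_energy a - b)) = 0"
    by (rule sum.neutral) auto
  moreover have "(\<Sum>a\<in>?C. c a * (u \<bullet> a + gap_energy a - b)) \<ge> 0"
    using c(1) supp C by (intro sum_nonneg mult_nonneg_nonneg) auto
  moreover have "(\<Sum>a\<in>?C. c a * (u' \<bullet> a + gap_energy a - b')) = 0"
    using tight' C by (intro sum.neutral) auto
  moreover have nonneg: "\<mu> * (u' \<bullet> a + gap_energy a - b') \<ge> 0" if "a \<in> ?T" for a
    using \<mu>(1) supp' that by auto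
  then have "(\<Sum>a\<in>?T. \<mu> * (u' \<bullet> a + gap_energy a - b')) \<ge> 0"
    by (rule sum_nonneg)
  ultimately have "(\<Sum>a\<in>?T. \<mu> * (u' \<bullet> a + gap_energy a - b')) = 0"
    unfolding expand[OF \<mu>(2) x_def[symmetric]] expand[OF c(2,3)] by linarith
  then have "\<forall>a\<in>?T. \<mu> * (u' \<bullet> a + gap_energy a - b') = 0"
    by (subst (asm) sum_nonneg_eq_0_iff[OF fin]) (fact nonneg)
  then have "\<forall>a\<in>?T. u' \<bullet> a + gap_energy a = b'" using \<mu>(1) by auto
  then have "?T \<subseteq> ?C" using tight' by blast
  then show ?thesis using root_clique_subset root_clique_carrier by blast
qed

lemma regular_dicing_A:
  assumes P: "polytope_type_A P"
  shows "regular lattice_A P (lattice_dicing_A P)"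
proof -
  have "finite (P \<inter> lattice_A)"
    using finite_lattice_A_Int polytope_imp_bounded polytope_type_A_facts(1)[OF P] by blast
  note reg = regular_subdivision_eq[OF this, of gap_energy]
  have "\<exists>u b. (\<forall>a\<in>P \<inter> lattice_A. b \<le> u \<bullet> a + gap_energy a) \<and>
      W = {a \<in> P \<inter> lattice_A. u \<bullet> a + gap_energy a = b}" if W: "root_clique W" "W \<subseteq> P" for W
  proof (cases "W = {}")
    case True
    \<comment> \<open>Energies are nonnegative, so the bound -1 for the zero functional is never
      attained and gives the empty face.\<close>
    have "0 \<le> gap_energy a" for a :: "real ^ 'a" by (simp add: gap_energy_def sum_nonneg)
    then have "(\<forall>a\<in>P \<inter> lattice_A. -1 \<le> 0 \<bullet> a + gap_energy a) \<and>
        {} = {a \<in> P \<inter> lattice_A. 0 \<bullet> a + gap_energy a = -1}"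
      by (auto simp: inner_zero_left) (smt (verit))+
    with True show ?thesis by blast
  next
    case False
    obtain u b where *: "\<forall>a\<in>lattice_A. b \<le> u \<bullet> a + gap_energy a \<and>
        (u \<bullet> a + gap_energy a = b \<longleftrightarrow> a \<in> W)"
      using root_clique_support[OF W(1) False] by blast
    have "W = {a \<in> P \<inter> lattice_A. u \<bullet> a + gap_energy a = b}"
      using * W unfolding root_clique_def by blast
    with * show ?thesis by blast
  qed
  moreover have "root_clique {a \<in> P \<inter> lattice_A. u \<bullet> a + gap_energy a = b}"
    if "\<forall>a\<in>P \<inter> lattice_A. b \<le> u \<bullet> a + gap_energy a" for u b
    using lower_face_root_clique[OF P] that by blast
  ultimately have "lattice_dicing_A P = regular_subdivision lattice_A P gap_energy"
    unfolding reg lattice_dicing_A_eq[OF P] by blast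
  then show ?thesis by (auto simp: regular_def)
qed

theorem theorem3p3:
  fixes P :: "(real ^ 'n) set"
  assumes "polytope_type_A P"
  shows "quadratic_triangulation lattice_A P (lattice_dicing_A P)"
proof -
  have "unimodular lattice_A (lattice_dicing_A P)"
    unfolding unimodular_def lattice_dicing_A_eq[OF assms]
    using unimodular_simplex_hull_root_clique by blast
  then show ?thesis
    unfolding quadratic_triangulation_def
    using assms lattice_triangulation_dicing_A regular_dicing_A flag_dicing_A by blast
qed

end
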